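(* For every $n\geq 0$, $$p(n)=\sum_{j=0}^n(-1)^j\operatorname{sc}(j)\,\#\mathcal H_{\mathrm{even}}\bigl(2(n-j)\bigr),$$ where $p(n)$ is the number of partitions of $n$, $\operatorname{sc}(j)$ is the number of self-conjugate partitions of $j$, and $\mathcal H_{\mathrm{even}}(2m)$ is the set of partitions of $2m$ for which the hook length of every cell on the main diagonal is even.
   Context: A partition is self-conjugate if it equals its conjugate (transpose). Hook lengths are the usual hook lengths in the Young diagram. *)

theory Defs
  imports Complex_Main
begin

text \<open>
  A partition is the list of its parts, positive and weakly decreasing; the empty list is the
  partition of 0. Rows and columns of Young diagrams are numbered from 0.
\<close>

definition is_partition :: "nat list \<Rightarrow> bool" where
  "is_partition l \<longleftrightarrow> sorted_wrt (\<ge>) l \<and> (\<forall>x\<in>set l. x > 0)"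

definition partitions :: "nat \<Rightarrow> nat list set" where
  "partitions n = {l. is_partition l \<and> sum_list l = n}"

definition diagram :: "nat list \<Rightarrow> (nat \<times> nat) set" where
  "diagram l = {(i, j). i < length l \<and> j < l ! i}"

text \<open>
  The parts of the conjugate are the column lengths of the diagram. There are as many columns as
  the largest part, which comes first; the case distinction is needed for the empty partition.
\<close>

definition conjugate :: "nat list \<Rightarrow> nat list" where
  "conjugate l = map (\<lambda>j. card {i. (i, j) \<in> diagram l}) [0..<(if l = [] then 0 else hd l)]"

definition self_conjugate :: "nat list \<Rightarrow> bool" where
  "self_conjugate l \<longleftrightarrow> conjugate l = l"

text \<open>The hook of a cell: the cell itself, its arm (to the right) and its leg (below).\<close>

definition hook :: "nat list \<Rightarrow> nat \<times> nat \<Rightarrow> (nat \<times> nat) set" where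
  "hook l c = {(i, j) \<in> diagram l. (i = fst c \<and> j \<ge> snd c) \<or> (j = snd c \<and> i \<ge> fst c)}"

definition hook_length :: "nat list \<Rightarrow> nat \<times> nat \<Rightarrow> nat" where
  "hook_length l c = card (hook l c)"

definition num_partitions :: "nat \<Rightarrow> nat" where
  "num_partitions n = card (partitions n)"

definition sc :: "nat \<Rightarrow> nat" where
  "sc n = card {l \<in> partitions n. self_conjugate l}"

definition H_even :: "nat \<Rightarrow> nat list set" where
  "H_even n = {l \<in> partitions n. \<forall>i. (i, i) \<in> diagram l \<longrightarrow> even (hook_length l (i, i))}"

lemma finite_partitions: "finite (partitions n)"
proof (rule finite_subset)
  show "partitions n \<subseteq> {l. set l \<subseteq> {..n} \<and> length l \<le> n}"
  proof
    fix l assume l: "l \<in> partitions n"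
    have "length xs \<le> sum_list xs" if "\<forall>x\<in>set xs. x > 0" for xs :: "nat list"
      using that by (induction xs) auto
    then show "l \<in> {l. set l \<subseteq> {..n} \<and> length l \<le> n}"
      using l member_le_sum_list by (auto simp: partitions_def is_partition_def)
  qed
qed (simp add: finite_lists_length_le)

lemma diagram_conjugate:
  assumes "is_partition l"
  shows "diagram (conjugate l) = (diagram l)\<inverse>"
proof -
  have mono: "l ! k \<le> l ! i" if "i \<le> k" "k < length l" for i k
    using assms that by (cases "i = k") (auto simp: is_partition_def sorted_wrt_iff_nth_less)
  have col: "i < card {i. (i, j) \<in> diagram l} \<longleftrightarrow> (i, j) \<in> diagram l" for i j
  proof -
    let ?C = "{i. (i, j) \<in> diagram l}"
    have fin: "finite ?C"
      by (rule finite_subset[of _ "{..<length l}"]) (auto simp: diagram_def)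
    have down: "i \<in> ?C" if "k \<in> ?C" "i \<le> k" for i k
      using that mono[of i k] by (auto simp: diagram_def)
    show ?thesis
    proof
      assume "i < card ?C"
      show "(i, j) \<in> diagram l"
      proof (rule ccontr)
        assume "(i, j) \<notin> diagram l"
        then have "k < i" if "k \<in> ?C" for k
          using down[OF that, of i] by (cases "k < i") auto
        then have "?C \<subseteq> {..<i}" by blast
        then have "card ?C \<le> i" using card_mono[of "{..<i}" ?C] by simp
        with \<open>i < card ?C\<close> show False by simp
      qed
    next
      assume "(i, j) \<in> diagram l"
      then have "{..i} \<subseteq> ?C" using down by blast
      then show "i < card ?C" using card_mono[OF fin, of "{..i}"] by simp
    qed
  qed
  have "j < (if l = [] then 0 else hd l)" if "(i, j) \<in> diagram l" for i j
    using that mono[of 0 i] by (auto simp: diagram_def hd_conv_nth)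
  moreover have "(j, i) \<in> diagram (conjugate l) \<longleftrightarrow>
      j < (if l = [] then 0 else hd l) \<and> i < card {i. (i, j) \<in> diagram l}" for i j
    by (simp add: diagram_def[of "conjugate l"]) (auto simp: conjugate_def)
  ultimately have "(j, i) \<in> diagram (conjugate l) \<longleftrightarrow> (i, j) \<in> diagram l" for i j
    unfolding col by metis
  then show ?thesis
    by (auto simp only: converse_iff)
qed

end

theory Submission
  imports Defs "HOL-Computational_Algebra.Formal_Power_Series"
begin

text \<open>
  Both kinds of partitions are described by their principal hooks. Self-conjugate partitions have
  the generating function \<open>\<Prod>(1 + q\<^sup>2\<^sup>i\<^sup>-\<^sup>1)\<close>, so the signs of the statement give
  \<open>\<Prod>(1 - q\<^sup>2\<^sup>i\<^sup>-\<^sup>1)\<close>. The arm and leg gaps between consecutive principal hooks are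
  independent of each other, and all principal hooks are even iff the arm and leg gaps have
  opposite parity at the innermost hook and equal parity elsewhere. Partitions of \<open>2m\<close> with
  this property and \<open>r\<close> principal hooks are therefore counted by the \<open>r\<close>-th term of a
  \<open>q\<close>-Gauss sum, which sums to \<open>\<Prod>(1 + q\<^sup>i)/(1 - q\<^sup>i)\<close>. By Euler's identity
  \<open>\<Prod>(1 - q\<^sup>2\<^sup>i\<^sup>-\<^sup>1)(1 + q\<^sup>i) = 1\<close> the product of the two is \<open>\<Prod>1/(1 - q\<^sup>i)\<close>.
  Infinite products and sums are truncated at \<open>N\<close> and compared modulo \<open>q\<^sup>N\<^sup>+\<^sup>1\<close>.
\<close>

section \<open>Removing the outermost principal hook\<close>

text \<open>A total version of \<open>hd\<close>: the value 0 at \<open>[]\<close> lets the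
  recursions below treat the empty partition uniformly.\<close>

definition first :: "nat list \<Rightarrow> nat" where
  "first l = (case l of [] \<Rightarrow> 0 | x # _ \<Rightarrow> x)"

lemma first_simps [simp]: "first [] = 0" "first (x # xs) = x"
  by (simp_all add: first_def)

lemma is_partition_Nil [simp]: "is_partition []"
  by (simp add: is_partition_def)

lemma is_partition_Cons [simp]:
  "is_partition (x # xs) \<longleftrightarrow> x > 0 \<and> first xs \<le> x \<and> is_partition xs"
  by (cases xs) (auto simp: is_partition_def)

text \<open>Geometrically this prepends a column of length \<open>length l + k\<close>: every old
  row grows by one cell, and the \<open>k\<close> extra rows consist of that column alone.\<close>

lemma is_partition_columns:
  "is_partition l \<Longrightarrow> is_partition (map Suc l @ replicate k (Suc 0))"
proof (induction l)
  case Nil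
  show ?case
  proof (induction k)
    case (Suc k)
    then show ?case by (cases k) auto
  qed simp
next
  case (Cons x l)
  then show ?case by (cases l; cases k) auto
qed

lemma is_partition_columnsE:
  assumes "is_partition xs"
  obtains l k where "is_partition l" "xs = map Suc l @ replicate k (Suc 0)"
proof -
  have "\<exists>l k. is_partition l \<and> xs = map Suc l @ replicate k (Suc 0)"
    using assms
  proof (induction xs)
    case Nil
    show ?case by (rule exI[of _ "[]"], rule exI[of _ 0]) simp
  next
    case (Cons x xs)
    then obtain l k where l: "is_partition l" "xs = map Suc l @ replicate k (Suc 0)"
      by auto
    show ?case
    proof (cases "x = 1")
      case True
      then have "l = []" using l Cons.prems by (cases l) auto
      then show ?thesis using True l
        by (intro exI[of _ "[]"] exI[of _ "Suc k"]) simp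
    next
      case False
      then obtain y where "x = Suc y" "y > 0" using Cons.prems by (cases x) auto
      then show ?thesis using l Cons.prems
        by (intro exI[of _ "y # l"] exI[of _ k]) (cases l; auto)
    qed
  qed
  then show thesis using that by blast
qed

text \<open>
  The diagram \<open>wrap a b l\<close> is that of \<open>l\<close>, moved one step along the diagonal and
  surrounded by a hook with arm \<open>a\<close> and leg \<open>b\<close>.
\<close>

definition wrap :: "nat \<Rightarrow> nat \<Rightarrow> nat list \<Rightarrow> nat list" where
  "wrap a b l = Suc a # map Suc l @ replicate (b - length l) (Suc 0)"

lemma first_wrap [simp]: "first (wrap a b l) = Suc a"
  by (simp add: wrap_def)

lemma wrap_neq_Nil [simp]: "wrap a b l \<noteq> []" "[] \<noteq> wrap a b l"
  by (simp_all add: wrap_def)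

lemma length_wrap [simp]: "length l \<le> b \<Longrightarrow> length (wrap a b l) = Suc b"
  by (simp add: wrap_def)

lemma sum_list_wrap [simp]:
  assumes "length l \<le> b"
  shows "sum_list (wrap a b l) = Suc (a + b) + sum_list l"
proof -
  have "sum_list (map Suc l) = sum_list l + length l" by (induction l) auto
  then show ?thesis using assms by (simp add: wrap_def sum_list_replicate)
qed

lemma is_partition_wrap:
  assumes "is_partition l" "first l \<le> a"
  shows "is_partition (wrap a b l)"
  using is_partition_columns[OF assms(1), of "b - length l"] assms(2)
  by (cases l; cases "b - length l") (auto simp: wrap_def)

lemma is_partition_wrapE:
  assumes "is_partition l" "l \<noteq> []"
  obtains a b l' where "is_partition l'" "first l' \<le> a" "length l' \<le> b" "l = wrap a b l'"
proof -
  obtain x xs where l: "l = x # xs" using assms by (cases l) auto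
  obtain l' k where l': "is_partition l'" "xs = map Suc l' @ replicate k (Suc 0)"
    using assms l is_partition_columnsE[of xs] by auto
  show thesis
    by (rule that[of l' "x - 1" "length l' + k"])
      (use assms l l' in \<open>cases l'; auto simp: wrap_def\<close>)+
qed

text \<open>The head determines \<open>a\<close> and the length determines \<open>b\<close>. Below
  the first row, exactly the entries above 1 come from \<open>l\<close>; the rest are
  padding.\<close>

lemma wrap_inject:
  assumes "wrap a b l = wrap a' b' l'" "is_partition l" "is_partition l'"
    and "length l \<le> b" "length l' \<le> b'"
  shows "a = a' \<and> b = b' \<and> l = l'"
proof -
  have filter: "filter (\<lambda>x. x > 1) (tl (wrap a b l)) = map Suc l" if "is_partition l" for a b l
  proof -
    have "filter (\<lambda>x. x > 1) (map Suc l) = map Suc l"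
      using that by (auto simp: filter_id_conv is_partition_def)
    then show ?thesis by (simp add: wrap_def)
  qed
  have "map Suc l = map Suc l'"
    using filter[of l a b] filter[of l' a' b'] assms by simp
  then have "l = l'" by simp
  moreover have "a = a'" using assms(1) by (simp add: wrap_def)
  moreover have "b = b'" using assms by (metis length_wrap Suc_inject)
  ultimately show ?thesis by simp
qed

lemma diagram_wrap:
  assumes "length l \<le> b"
  shows "(0, j) \<in> diagram (wrap a b l) \<longleftrightarrow> j \<le> a"
    and "(Suc i, 0) \<in> diagram (wrap a b l) \<longleftrightarrow> i < b"
    and "(Suc i, Suc j) \<in> diagram (wrap a b l) \<longleftrightarrow> (i, j) \<in> diagram l"
  using assms by (auto simp: diagram_def wrap_def nth_append less_Suc_eq_le)

lemma hook_length_wrap_0: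
  assumes "length l \<le> b"
  shows "hook_length (wrap a b l) (0, 0) = Suc (a + b)"
proof -
  have "hook (wrap a b l) (0, 0) = (\<lambda>j. (0, j)) ` {..a} \<union> (\<lambda>i. (Suc i, 0)) ` {..<b}"
  proof -
    have "(i, j) \<in> hook (wrap a b l) (0, 0) \<longleftrightarrow>
      (i, j) \<in> (\<lambda>j. (0, j)) ` {..a} \<union> (\<lambda>i. (Suc i, 0)) ` {..<b}" for i j
      by (cases i; cases j) (auto simp: hook_def diagram_wrap[OF assms])
    then show ?thesis by auto
  qed
  also have "card \<dots> = Suc a + b"
    by (subst card_Un_disjoint) (auto simp: card_image inj_on_def)
  finally show ?thesis by (simp add: hook_length_def)
qed

text \<open>A hook only extends right and down, so it never meets the added row and column; the
  diagonal shift carries it over unchanged.\<close>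

lemma hook_length_wrap_Suc:
  assumes "length l \<le> b"
  shows "hook_length (wrap a b l) (Suc i, Suc j) = hook_length l (i, j)"
proof -
  have "(x, y) \<in> hook (wrap a b l) (Suc i, Suc j) \<longleftrightarrow>
      (x, y) \<in> map_prod Suc Suc ` hook l (i, j)" for x y
    by (cases x; cases y) (auto simp: hook_def diagram_wrap[OF assms])
  then have "hook (wrap a b l) (Suc i, Suc j) = map_prod Suc Suc ` hook l (i, j)"
    by auto
  moreover have "inj_on (map_prod Suc Suc) (hook l (i, j))"
    by (auto simp: inj_on_def)
  ultimately show ?thesis by (simp add: hook_length_def card_image)
qed

text \<open>The condition of \<open>H_even\<close> freed from the size, so that it can be peeled off
  hook by hook.\<close>

definition even_hooks :: "nat list \<Rightarrow> bool" where
  "even_hooks l \<longleftrightarrow> (\<forall>i. (i, i) \<in> diagram l \<longrightarrow> even (hook_length l (i, i)))"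

lemma even_hooks_Nil [simp]: "even_hooks []"
  by (simp add: even_hooks_def diagram_def)

lemma even_hooks_wrap:
  assumes "length l \<le> b"
  shows "even_hooks (wrap a b l) \<longleftrightarrow> odd (a + b) \<and> even_hooks l"
proof -
  have "even_hooks (wrap a b l) \<longleftrightarrow>
    even (hook_length (wrap a b l) (0, 0)) \<and>
    (\<forall>i. (Suc i, Suc i) \<in> diagram (wrap a b l) \<longrightarrow> even (hook_length (wrap a b l) (Suc i, Suc i)))"
    unfolding even_hooks_def
    by (metis diagram_wrap(1)[OF assms] le0 not0_implies_Suc)
  then show ?thesis
    by (simp add: hook_length_wrap_0 hook_length_wrap_Suc diagram_wrap assms even_hooks_def)
qed

section \<open>Self-conjugacy as symmetry of the diagram\<close>

lemma list_eq_diagram: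
  assumes "\<forall>x\<in>set l. x > 0" "\<forall>x\<in>set m. x > 0" "diagram l = diagram m"
  shows "l = m"
proof -
  \<comment> \<open>Zero parts leave no cells, so positivity is what allows the number of rows to be
    read off column 0.\<close>
  have len: "i < length l \<longleftrightarrow> (i, 0) \<in> diagram l" if "\<forall>x\<in>set l. x > 0" for i l
    using that by (auto simp: diagram_def)
  have eq: "i < length l \<longleftrightarrow> i < length m" for i
    using len assms by metis
  have length: "length l = length m"
    using eq[of "length l"] eq[of "length m"] by simp
  moreover have "l ! i = m ! i" if "i < length l" for i
  proof -
    have "j < l ! i \<longleftrightarrow> j < m ! i" for j
      using assms(3) that length by (auto simp: diagram_def set_eq_iff)
    from this[of "l ! i"] this[of "m ! i"] show ?thesis by simp
  qed
  ultimately show ?thesis by (rule nth_equalityI)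
qed

lemma self_conjugate_iff_sym:
  assumes "is_partition l"
  shows "self_conjugate l \<longleftrightarrow> sym (diagram l)"
proof
  assume "self_conjugate l"
  then show "sym (diagram l)"
    using diagram_conjugate[OF assms] by (simp add: self_conjugate_def sym_conv_converse_eq)
next
  assume "sym (diagram l)"
  then have eq: "diagram (conjugate l) = diagram l"
    using diagram_conjugate[OF assms] by (simp add: sym_conv_converse_eq)
  \<comment> \<open>Needed for \<open>list_eq_diagram\<close>: every column left of
    \<open>hd l\<close> meets row 0, so no column is empty.\<close>
  have "x > 0" if x: "x \<in> set (conjugate l)" for x
  proof -
    obtain j where j: "l \<noteq> []" "j < hd l" "x = card {i. (i, j) \<in> diagram l}"
      using x by (auto simp: conjugate_def split: if_splits)
    have "finite {i. (i, j) \<in> diagram l}"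
      by (rule finite_subset[of _ "{..<length l}"]) (auto simp: diagram_def)
    moreover have "0 \<in> {i. (i, j) \<in> diagram l}"
      using j by (auto simp: diagram_def hd_conv_nth)
    ultimately show ?thesis using j by (auto simp: card_gt_0_iff)
  qed
  then show "self_conjugate l"
    unfolding self_conjugate_def
    by (intro list_eq_diagram eq) (use assms in \<open>auto simp: is_partition_def\<close>)
qed

lemma self_conjugate_wrap:
  assumes "is_partition l" "first l \<le> a" "length l \<le> b"
  shows "self_conjugate (wrap a b l) \<longleftrightarrow> a = b \<and> self_conjugate l"
proof -
  have "sym (diagram (wrap a b l)) \<longleftrightarrow> a = b \<and> sym (diagram l)"
  proof
    assume s: "sym (diagram (wrap a b l))"
    have "sym (diagram l)"
      by (rule symI) (use s diagram_wrap(3)[OF assms(3)] in \<open>metis symD\<close>)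
    \<comment> \<open>Compares the cell \<open>(0, i)\<close> with its mirror image
      \<open>(i, 0)\<close>: row 0 ends at column \<open>a\<close>, column 0 at row
      \<open>b\<close>.\<close>
    moreover have "i \<le> a \<longleftrightarrow> i \<le> b" for i
    proof (cases i)
      case (Suc k)
      then show ?thesis
        using s diagram_wrap(1)[OF assms(3), of i a] diagram_wrap(2)[OF assms(3), of k a]
        by (metis Suc_le_eq symD)
    qed simp
    then have "a = b" by (metis le_antisym order_refl)
    ultimately show "a = b \<and> sym (diagram l)" by simp
  next
    assume s: "a = b \<and> sym (diagram l)"
    show "sym (diagram (wrap a b l))"
    proof (rule symI)
      fix i j assume "(i, j) \<in> diagram (wrap a b l)"
      then show "(j, i) \<in> diagram (wrap a b l)"
        using s by (cases i; cases j) (auto simp: diagram_wrap[OF assms(3)] dest: symD)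
    qed
  qed
  then show ?thesis
    using assms is_partition_wrap by (simp add: self_conjugate_iff_sym)
qed

lemma self_conjugate_Nil [simp]: "self_conjugate []"
  by (simp add: self_conjugate_def conjugate_def)

text \<open>Turns a bound on the largest part into one on the number of rows, as the side condition
  of \<open>wrap\<close> requires.\<close>

lemma self_conjugate_length:
  assumes "is_partition l" "self_conjugate l"
  shows "length l = first l"
proof (cases "l = []")
  case False
  then obtain a b l' where "is_partition l'" "first l' \<le> a" "length l' \<le> b" "l = wrap a b l'"
    using is_partition_wrapE[OF assms(1)] by metis
  then show ?thesis using assms by (simp add: self_conjugate_wrap)
qed simp

section \<open>Gaps between consecutive principal hooks\<close>

text \<open>
  The list records, from the outermost principal hook inwards, by how much arm and leg exceed the
  least values that the enclosed diagram allows. Every list of pairs is admissible.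
\<close>

fun build :: "(nat \<times> nat) list \<Rightarrow> nat list" where
  "build [] = []"
| "build ((d, e) # gs) = wrap (first (build gs) + d) (length (build gs) + e) (build gs)"

lemma is_partition_build [simp]: "is_partition (build gs)"
  by (induction gs rule: build.induct) (auto intro: is_partition_wrap)

lemma inj_build: "inj build"
proof (rule injI)
  show "gs = hs" if "build gs = build hs" for gs hs
    using that
  proof (induction gs arbitrary: hs rule: build.induct)
    case 1
    then show ?case by (cases hs rule: build.cases) auto
  next
    case (2 d e gs)
    show ?case
    proof (cases hs rule: build.cases)
      case 1
      then show ?thesis using 2 by simp
    next
      case (2 d' e' hs')
      then show ?thesis
        using "2.prems" "2.IH"[of hs'] wrap_inject[OF "2.prems"[unfolded 2 build.simps]] by auto
    qed
  qed
qed

text \<open>Together with \<open>inj_build\<close> this makes \<open>build\<close> a bijection from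
  lists of pairs onto partitions. The gaps are the excess of the arm over \<open>first l'\<close>
  and of the leg over \<open>length l'\<close>.\<close>

lemma buildE:
  assumes "is_partition l"
  obtains gs where "l = build gs"
proof -
  have "\<exists>gs. build gs = l" using assms
  proof (induction "length l" arbitrary: l rule: less_induct)
    case less
    show ?case
    proof (cases "l = []")
      case True
      then show ?thesis by (intro exI[of _ "[]"]) simp
    next
      case False
      then obtain a b l' where l: "is_partition l'" "first l' \<le> a" "length l' \<le> b" "l = wrap a b l'"
        using is_partition_wrapE[OF less.prems] by metis
      then obtain gs where "build gs = l'" using less.hyps[of l'] by auto
      then have "build ((a - first l', b - length l') # gs) = l" using l by simp
      then show ?thesis by blast
    qed
  qed
  then show thesis using that by blast
qed

section \<open>Hook parity and size in terms of gaps\<close>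

fun gap_sum :: "(nat \<times> nat) list \<Rightarrow> nat" where
  "gap_sum [] = 0"
| "gap_sum ((d, e) # gs) = d + e + 2 + gap_sum gs"

lemma gap_sum_append [simp]: "gap_sum (gs @ hs) = gap_sum gs + gap_sum hs"
  by (induction gs rule: gap_sum.induct) auto

text \<open>The corner cell lies in both the first row and the first column, so for nonempty
  \<open>gs\<close> this sum is one more than the outermost hook length. Even hooks thus correspond
  to odd gap sums.\<close>

lemma first_add_length_build: "first (build gs) + length (build gs) = gap_sum gs"
  by (induction gs rule: build.induct) auto

lemma even_hooks_build_Cons:
  "even_hooks (build ((d, e) # gs)) \<longleftrightarrow> odd (gap_sum ((d, e) # gs)) \<and> even_hooks (build gs)"
  using first_add_length_build[of gs, symmetric] by (auto simp: even_hooks_wrap)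

lemma even_gap_sum: "\<forall>(d, e)\<in>set gs. even (d + e) \<Longrightarrow> even (gap_sum gs)"
  by (induction gs rule: gap_sum.induct) auto

text \<open>The last pair is the innermost hook and must make its gap sum odd. Each further hook
  outwards keeps the gap sum odd exactly when its own \<open>d + e\<close> is even.\<close>

lemma even_hooks_build_snoc:
  "even_hooks (build (gs @ [(d, e)])) \<longleftrightarrow> odd (d + e) \<and> (\<forall>(d, e)\<in>set gs. even (d + e))"
proof (induction gs)
  case Nil
  show ?case using even_hooks_build_Cons[of d e "[]"] by simp
next
  case (Cons g gs)
  obtain a b where g: "g = (a, b)" by (cases g)
  show ?case
    using even_hooks_build_Cons[of a b "gs @ [(d, e)]"] Cons.IH even_gap_sum[of gs]
    by (auto simp: g)
qed

lemma sum_list_build_Cons: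
  "Suc (sum_list (build ((d, e) # gs))) = gap_sum ((d, e) # gs) + sum_list (build gs)"
  using first_add_length_build[of gs, symmetric] by simp

text \<open>The innermost gaps lengthen each of the \<open>Suc (length gs)\<close> hooks by
  \<open>d + e + 2\<close>, except that the new hook itself has only \<open>d + e + 1\<close> cells;
  this accounts for the \<open>Suc\<close> on the left.\<close>

lemma sum_list_build_snoc:
  "Suc (sum_list (build (gs @ [(d, e)]))) = sum_list (build gs) + Suc (length gs) * (d + e + 2)"
proof (induction gs)
  case Nil
  show ?case using sum_list_build_Cons[of d e "[]"] by simp
next
  case (Cons g gs)
  obtain a b where g: "g = (a, b)" by (cases g)
  show ?case
    using sum_list_build_Cons[of a b "gs @ [(d, e)]"] sum_list_build_Cons[of a b gs] Cons.IH
    by (simp add: g del: build.simps)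
qed

text \<open>
  Half the size of the partition \<open>build (rev gs)\<close>: a gap is counted once for each principal
  hook that is not inside it, so for counting it is convenient to list the gaps from the innermost.
\<close>

fun weight :: "(nat \<times> nat) list \<Rightarrow> nat" where
  "weight [] = 0"
| "weight ((d, e) # gs) = Suc (length gs) * Suc ((d + e) div 2) + weight gs"

lemma length_le_weight: "length gs \<le> weight gs"
  by (induction gs rule: weight.induct) auto

definition even_gaps :: "nat \<Rightarrow> (nat \<times> nat) list set" where
  "even_gaps r = {gs. length gs = r \<and> (\<forall>(d, e)\<in>set gs. even (d + e))}"

definition H_gaps :: "nat \<Rightarrow> (nat \<times> nat) list set" where
  "H_gaps r = {gs. length gs = r \<and> even_hooks (build (rev gs))}"

lemma even_gaps_0: "even_gaps 0 = {[]}"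
  by (auto simp: even_gaps_def)

lemma even_gaps_Suc:
  "even_gaps (Suc r) = (\<lambda>(g, gs). g # gs) ` ({(d, e). even (d + e)} \<times> even_gaps r)"
  by (auto simp: even_gaps_def length_Suc_conv image_iff)

lemma H_gaps_0: "H_gaps 0 = {[]}"
  by (auto simp: H_gaps_def)

lemma H_gaps_Suc:
  "H_gaps (Suc r) = (\<lambda>(g, gs). g # gs) ` ({(d, e). odd (d + e)} \<times> even_gaps r)"
  by (auto simp: H_gaps_def even_gaps_def length_Suc_conv image_iff even_hooks_build_snoc)

text \<open>Here halving \<open>d + e\<close> loses nothing, so \<open>2 * weight gs\<close> is the
  sum of the gap sums over all hooks, which exceeds the size by one per hook.\<close>

lemma sum_list_build_even_gaps:
  "\<forall>(d, e)\<in>set gs. even (d + e) \<Longrightarrow> sum_list (build (rev gs)) + length gs = 2 * weight gs"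
proof (induction gs rule: weight.induct)
  case (2 d e gs)
  define s where "s = (d + e) div 2"
  have s: "d + e = 2 * s" using 2 by (auto simp: s_def)
  have "d + e + 2 = 2 * Suc s" using s by simp
  then have "Suc (sum_list (build (rev gs @ [(d, e)]))) + length gs
      = 2 * weight gs + Suc (length gs) * (2 * Suc s)"
    using 2 sum_list_build_snoc[of "rev gs" d e] by simp
  then show ?case by (simp add: s_def[symmetric] del: build.simps)
qed simp

lemma sum_list_build_H_gaps:
  assumes "gs \<in> H_gaps r"
  shows "sum_list (build (rev gs)) = 2 * weight gs"
proof (cases gs rule: weight.cases)
  case (2 d e hs)
  have hs: "odd (d + e)" "\<forall>(d, e)\<in>set hs. even (d + e)"
    using assms even_hooks_build_snoc[of "rev hs" d e] by (auto simp: 2 H_gaps_def)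
  define s where "s = (d + e) div 2"
  have "d + e = 2 * s + 1" using hs by (auto simp: s_def)
  then have "d + e + 2 = 2 * Suc s + 1" by simp
  \<comment> \<open>The odd innermost pair loses 1 when halved, once for each of the
    \<open>Suc (length hs)\<close> hooks. This cancels the excess of one per hook, so twice the
    weight is exactly the size.\<close>
  then have "Suc (sum_list (build (rev hs @ [(d, e)]))) + length hs
      = 2 * weight hs + Suc (length hs) * (2 * Suc s + 1)"
    using sum_list_build_even_gaps[OF hs(2)] sum_list_build_snoc[of "rev hs" d e] by simp
  then show ?thesis by (simp add: 2 s_def[symmetric] algebra_simps del: build.simps)
qed simp

text \<open>Counts through the bijection \<open>build\<close>, with gaps listed from the innermost.
  A list of weight \<open>m\<close> has at most \<open>m\<close> entries, so \<open>r\<close> may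
  stop at any \<open>N\<close> that is at least \<open>m\<close>.\<close>

lemma card_H_even:
  assumes "m \<le> N"
  shows "card (H_even (2 * m)) = (\<Sum>r\<le>N. card {gs \<in> H_gaps r. weight gs = m})"
proof -
  have H: "H_even (2 * m) = {l. is_partition l \<and> even_hooks l \<and> sum_list l = 2 * m}"
    by (auto simp: H_even_def partitions_def even_hooks_def)
  let ?F = "\<lambda>r. {gs \<in> H_gaps r. weight gs = m}"
  have inj: "inj_on (\<lambda>gs. build (rev gs)) A" for A
    using inj_build by (auto simp: inj_on_def)
  have eq: "H_even (2 * m) = (\<lambda>gs. build (rev gs)) ` (\<Union>r\<le>N. ?F r)"
  proof (intro equalityI subsetI)
    fix l assume l: "l \<in> H_even (2 * m)"
    then obtain gs where "l = build (rev gs)"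
      unfolding H by (metis (mono_tags, lifting) buildE mem_Collect_eq rev_rev_ident)
    moreover have "gs \<in> H_gaps (length gs)"
      using l calculation by (auto simp: H_gaps_def H)
    moreover have "weight gs = m"
      using sum_list_build_H_gaps[OF calculation(2)] l calculation(1) by (simp add: H)
    moreover have "length gs \<le> N"
      using calculation(3) length_le_weight[of gs] assms by simp
    ultimately show "l \<in> (\<lambda>gs. build (rev gs)) ` (\<Union>r\<le>N. ?F r)" by blast
  next
    fix l assume "l \<in> (\<lambda>gs. build (rev gs)) ` (\<Union>r\<le>N. ?F r)"
    then show "l \<in> H_even (2 * m)"
      using sum_list_build_H_gaps by (auto simp: H H_gaps_def)
  qed
  have "finite (H_even (2 * m))"
    using finite_partitions by (simp add: H_even_def)
  \<comment> \<open>Finiteness of the sets of gap lists is pulled back from the partitions along the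
    injection.\<close>
  then have fin: "finite (\<Union>r\<le>N. ?F r)"
    unfolding eq by (rule finite_imageD[OF _ inj])
  have "card (H_even (2 * m)) = card (\<Union>r\<le>N. ?F r)"
    unfolding eq by (rule card_image[OF inj])
  also have "\<dots> = (\<Sum>r\<le>N. card (?F r))"
    using fin by (intro card_UN_disjoint) (auto simp: H_gaps_def)
  finally show ?thesis .
qed

section \<open>Generating functions of weighted sets\<close>

unbundle fps_syntax

definition gf :: "'a set \<Rightarrow> ('a \<Rightarrow> nat) \<Rightarrow> real fps" where
  "gf A w = Abs_fps (\<lambda>n. real (card {x \<in> A. w x = n}))"

text \<open>Infinite sets have \<open>card\<close> 0, so the sum and product rules for
  \<open>gf\<close> are stated for finite fibres.\<close>

definition finite_fibres :: "'a set \<Rightarrow> ('a \<Rightarrow> nat) \<Rightarrow> bool" where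
  "finite_fibres A w \<longleftrightarrow> (\<forall>n. finite {x \<in> A. w x = n})"

lemma gf_nth [simp]: "gf A w $ n = real (card {x \<in> A. w x = n})"
  by (simp add: gf_def)

lemma gf_Un:
  assumes "finite_fibres A w" "finite_fibres B w" "A \<inter> B = {}"
  shows "gf (A \<union> B) w = gf A w + gf B w"
proof (rule fps_ext)
  fix n
  have "{x \<in> A \<union> B. w x = n} = {x \<in> A. w x = n} \<union> {x \<in> B. w x = n}" by auto
  then show "gf (A \<union> B) w $ n = (gf A w + gf B w) $ n"
    using assms by (simp add: finite_fibres_def card_Un_disjoint disjoint_iff)
qed

lemma image_fibre:
  fixes v :: "'a \<Rightarrow> nat"
  assumes "\<And>x. x \<in> A \<Longrightarrow> w (f x) = k + v x"
  shows "{y \<in> f ` A. w y = n} = (if n < k then {} else f ` {x \<in> A. v x = n - k})"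
  by (auto simp: assms)

lemma finite_fibres_image:
  assumes "\<And>x. x \<in> A \<Longrightarrow> w (f x) = k + v x" "finite_fibres A v"
  shows "finite_fibres (f ` A) w"
  using assms by (simp add: finite_fibres_def image_fibre[of A w f k v, OF assms(1)])

lemma gf_image:
  assumes "\<And>x. x \<in> A \<Longrightarrow> w (f x) = k + v x" "inj_on f A"
  shows "gf (f ` A) w = fps_X ^ k * gf A v"
proof (rule fps_ext)
  fix n
  have "inj_on f {x \<in> A. v x = n - k}"
    using assms(2) by (rule inj_on_subset) auto
  then show "gf (f ` A) w $ n = (fps_X ^ k * gf A v) $ n"
    by (simp add: fps_X_power_mult_nth image_fibre[of A w f k v, OF assms(1)] card_image)
qed

lemma times_fibre:
  fixes v :: "'a \<Rightarrow> nat" and w :: "'b \<Rightarrow> nat"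
  shows
  "{p \<in> A \<times> B. (case p of (x, y) \<Rightarrow> v x + w y) = n}
    = (\<Union>i\<in>{0..n}. {x \<in> A. v x = i} \<times> {y \<in> B. w y = n - i})"
  by auto

lemma finite_fibres_times:
  assumes "finite_fibres A v" "finite_fibres B w"
  shows "finite_fibres (A \<times> B) (\<lambda>(x, y). v x + w y)"
  using assms by (simp add: finite_fibres_def times_fibre)

lemma gf_times:
  assumes "finite_fibres A v" "finite_fibres B w"
  shows "gf (A \<times> B) (\<lambda>(x, y). v x + w y) = gf A v * gf B w"
proof (rule fps_ext)
  fix n
  have "card (\<Union>i\<in>{0..n}. {x \<in> A. v x = i} \<times> {y \<in> B. w y = n - i})
      = (\<Sum>i\<in>{0..n}. card ({x \<in> A. v x = i} \<times> {y \<in> B. w y = n - i}))"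
    using assms by (intro card_UN_disjoint) (auto simp: finite_fibres_def)
  then show "gf (A \<times> B) (\<lambda>(x, y). v x + w y) $ n = (gf A v * gf B w) $ n"
    by (simp add: times_fibre fps_mult_nth card_cartesian_product)
qed

lemma gf_singleton:
  assumes "w x = 0"
  shows "gf {x} w = 1"
proof (rule fps_ext)
  fix n
  have "{y \<in> {x}. w y = n} = (if n = 0 then {x} else {})" using assms by auto
  then show "gf {x} w $ n = 1 $ n" by simp
qed

lemma finite_fibres_partitions:
  "A \<subseteq> Collect is_partition \<Longrightarrow> finite_fibres A sum_list"
  unfolding finite_fibres_def
  by (intro allI finite_subset[OF _ finite_partitions]) (auto simp: partitions_def)

section \<open>Generating functions of gap pairs and gap lists\<close>

abbreviation q :: "real fps" where "q \<equiv> fps_X"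

definition geo :: "nat \<Rightarrow> real fps" where
  "geo k = inverse (1 - q ^ k)"

lemma geo: "k > 0 \<Longrightarrow> (1 - q ^ k) * geo k = 1"
  unfolding geo_def by (rule inverse_mult_eq_1') auto

lemma one_minus_q_power_neq_0: "k > 0 \<Longrightarrow> 1 - q ^ k \<noteq> 0"
  using geo[of k] by auto

lemma finite_fibres_mult: "k > 0 \<Longrightarrow> finite_fibres UNIV (\<lambda>u. k * u)"
  unfolding finite_fibres_def
proof
  fix n :: nat assume "k > 0"
  then have "{u \<in> UNIV. k * u = n} \<subseteq> {n div k}" by auto
  then show "finite {u \<in> UNIV. k * u = n}" by (rule finite_subset) simp
qed

text \<open>Splitting off \<open>u = 0\<close> gives the equation \<open>G = 1 + q ^ k * G\<close>,
  which determines the geometric series after cancelling \<open>1 - q ^ k\<close>.\<close>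

lemma gf_mult:
  assumes "k > 0"
  shows "gf UNIV (\<lambda>u. k * u) = geo k"
proof -
  have "u \<in> {0} \<union> range Suc" for u by (cases u) auto
  then have U: "{0} \<union> range Suc = UNIV" by blast
  have "finite_fibres A (\<lambda>u. k * u)" for A
    using finite_fibres_mult[OF assms] unfolding finite_fibres_def
    by (metis (no_types, lifting) Collect_mono UNIV_I finite_subset)
  then have "gf ({0} \<union> range Suc) (\<lambda>u. k * u) = gf {0} (\<lambda>u. k * u) + gf (range Suc) (\<lambda>u. k * u)"
    by (intro gf_Un) auto
  then have "gf UNIV (\<lambda>u. k * u) = gf {0} (\<lambda>u. k * u) + gf (range Suc) (\<lambda>u. k * u)"
    by (simp only: U)
  also have "gf (range Suc) (\<lambda>u. k * u) = q ^ k * gf UNIV (\<lambda>u. k * u)"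
    by (rule gf_image) auto
  also have "gf {0} (\<lambda>u. k * u) = 1"
    by (rule gf_singleton) simp
  finally have eq: "gf UNIV (\<lambda>u. k * u) = 1 + q ^ k * gf UNIV (\<lambda>u. k * u)" .
  have "(1 - q ^ k) * gf UNIV (\<lambda>u. k * u) = 1"
    unfolding left_diff_distrib mult_1_left diff_eq_eq by (rule eq)
  then have "(1 - q ^ k) * gf UNIV (\<lambda>u. k * u) = (1 - q ^ k) * geo k"
    by (simp only: geo[OF assms])
  then show ?thesis using one_minus_q_power_neq_0[OF assms] by simp
qed

lemma gf_pairs:
  assumes "k > 0"
  shows "finite_fibres (UNIV \<times> UNIV) (\<lambda>(u, v). k * u + k * v)"
    and "gf (UNIV \<times> UNIV) (\<lambda>(u, v). k * u + k * v) = geo k ^ 2"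
  using finite_fibres_times[OF finite_fibres_mult[OF assms] finite_fibres_mult[OF assms]]
    gf_times[OF finite_fibres_mult[OF assms] finite_fibres_mult[OF assms]]
  by (simp_all add: gf_mult[OF assms] power2_eq_square)

lemma gf_pairs_image:
  assumes "k > 0" "inj f" "\<And>u v. w (f (u, v)) = c + (k * u + k * v)"
  shows "finite_fibres (range f) w" "gf (range f) w = q ^ c * geo k ^ 2"
proof -
  have w: "w (f x) = c + (\<lambda>(u, v). k * u + k * v) x" for x
    by (cases x) (simp add: assms(3))
  show "finite_fibres (range f) w"
    by (rule finite_fibres_image
        [where A = UNIV and w = w
          and k = c and f = f and v = "\<lambda>(u, v). k * u + k * v", OF w]) (use gf_pairs(1)[OF assms(1)] in simp)
  show "gf (range f) w = q ^ c * geo k ^ 2"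
    by (subst gf_image
        [where A = UNIV and w = w
          and k = c and f = f and v = "\<lambda>(u, v). k * u + k * v", OF w assms(2)]) (use gf_pairs(2)[OF assms(1)] in simp)
qed

text \<open>Fixing both parities removes the floor: with \<open>d = 2 * u + i\<close> and
  \<open>e = 2 * v + j\<close> the weight is a constant plus \<open>k * u + k * v\<close>.\<close>

lemma gf_residue_pairs:
  assumes "k > 0" "i < 2" "j < 2"
  defines "w \<equiv> \<lambda>(d, e). k * Suc ((d + e) div 2)"
  shows "finite_fibres {(d, e). d mod 2 = i \<and> e mod 2 = j} w"
    and "gf {(d, e). d mod 2 = i \<and> e mod 2 = j} w = q ^ (k * Suc ((i + j) div 2)) * geo k ^ 2"
proof -
  define f where "f = (\<lambda>(u, v). (2 * u + i, 2 * v + j))"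
  have "(d, e) \<in> range f \<longleftrightarrow> d mod 2 = i \<and> e mod 2 = j" for d e
  proof
    assume "d mod 2 = i \<and> e mod 2 = j"
    then have "(d, e) = f (d div 2, e div 2)" by (auto simp: f_def)
    then show "(d, e) \<in> range f" by blast
  qed (use assms(2,3) in \<open>auto simp: f_def\<close>)
  then have range: "range f = {(d, e). d mod 2 = i \<and> e mod 2 = j}"
    by (intro set_eqI) (simp only: split_paired_all mem_Collect_eq case_prod_conv)
  have inj: "inj f" by (auto simp: inj_def f_def)
  have w: "w (f (u, v)) = k * Suc ((i + j) div 2) + (k * u + k * v)" for u v
  proof -
    have "2 * u + i + (2 * v + j) = i + j + 2 * (u + v)" by simp
    then have "(2 * u + i + (2 * v + j)) div 2 = (i + j) div 2 + (u + v)"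
      by (metis add.commute div_mult_self2 zero_neq_numeral)
    then show ?thesis by (simp add: w_def f_def algebra_simps)
  qed
  show "finite_fibres {(d, e). d mod 2 = i \<and> e mod 2 = j} w"
    and "gf {(d, e). d mod 2 = i \<and> e mod 2 = j} w = q ^ (k * Suc ((i + j) div 2)) * geo k ^ 2"
    using gf_pairs_image[OF assms(1) inj w] by (simp_all add: range)
qed

lemma finite_fibres_Un:
  "finite_fibres A w \<Longrightarrow> finite_fibres B w \<Longrightarrow> finite_fibres (A \<union> B) w"
  unfolding finite_fibres_def
proof
  fix n assume "\<forall>n. finite {x \<in> A. w x = n}" "\<forall>n. finite {x \<in> B. w x = n}"
  moreover have "{x \<in> A \<union> B. w x = n} = {x \<in> A. w x = n} \<union> {x \<in> B. w x = n}" by auto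
  ultimately show "finite {x \<in> A \<union> B. w x = n}" by simp
qed

text \<open>The class of two even numbers starts at \<open>q ^ k\<close>, that of two odd numbers at
  \<open>q ^ (2 * k)\<close>; hence the factor \<open>1 + q ^ k\<close>.\<close>

lemma gf_even_pairs:
  assumes "k > 0"
  defines "w \<equiv> \<lambda>(d, e). k * Suc ((d + e) div 2)"
  shows "finite_fibres {(d, e). even (d + e)} w"
    and "gf {(d, e). even (d + e)} w = q ^ k * (1 + q ^ k) * geo k ^ 2"
proof -
  have "even (d + e) \<longleftrightarrow> d mod 2 = 0 \<and> e mod 2 = 0 \<or> d mod 2 = 1 \<and> e mod 2 = 1" for d e :: nat
    by presburger
  then have U: "{(d, e). even (d + e)} = {(d, e). d mod 2 = 0 \<and> e mod 2 = 0} \<union>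
      {(d::nat, e). d mod 2 = 1 \<and> e mod 2 = 1}"
    by (intro set_eqI) (simp only: mem_Collect_eq Un_iff case_prod_beta)
  note f = gf_residue_pairs[OF assms(1), of 0 0] and g = gf_residue_pairs[OF assms(1), of 1 1]
  show "finite_fibres {(d, e). even (d + e)} w"
    unfolding U w_def by (intro finite_fibres_Un f(1) g(1)) auto
  have "gf {(d, e). even (d + e)} w = q ^ k * geo k ^ 2 + q ^ (2 * k) * geo k ^ 2"
    unfolding U w_def by (subst gf_Un) (use f g in \<open>auto simp: mult.commute\<close>)
  also have "q ^ (2 * k) = q ^ k * q ^ k"
    by (simp only: mult_2 power_add)
  finally show "gf {(d, e). even (d + e)} w = q ^ k * (1 + q ^ k) * geo k ^ 2"
    by (simp only: distrib_left distrib_right mult_1_right)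
qed

text \<open>Both mixed parity classes start at \<open>q ^ k\<close>; hence the factor 2.\<close>

lemma gf_odd_pairs:
  assumes "k > 0"
  defines "w \<equiv> \<lambda>(d, e). k * Suc ((d + e) div 2)"
  shows "finite_fibres {(d, e). odd (d + e)} w"
    and "gf {(d, e). odd (d + e)} w = 2 * q ^ k * geo k ^ 2"
proof -
  have "odd (d + e) \<longleftrightarrow> d mod 2 = 0 \<and> e mod 2 = 1 \<or> d mod 2 = 1 \<and> e mod 2 = 0" for d e :: nat
    by presburger
  then have U: "{(d, e). odd (d + e)} = {(d, e). d mod 2 = 0 \<and> e mod 2 = 1} \<union>
      {(d::nat, e). d mod 2 = 1 \<and> e mod 2 = 0}"
    by (intro set_eqI) (simp only: mem_Collect_eq Un_iff case_prod_beta)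
  note f = gf_residue_pairs[OF assms(1), of 0 1] and g = gf_residue_pairs[OF assms(1), of 1 0]
  show "finite_fibres {(d, e). odd (d + e)} w"
    unfolding U w_def by (intro finite_fibres_Un f(1) g(1)) auto
  have "gf {(d, e). odd (d + e)} w = q ^ k * geo k ^ 2 + q ^ k * geo k ^ 2"
    unfolding U w_def by (subst gf_Un) (use f g in \<open>auto simp: mult.commute\<close>)
  then show "gf {(d, e). odd (d + e)} w = 2 * q ^ k * geo k ^ 2" by simp
qed

text \<open>The tail has fixed length \<open>r\<close>, so the multiplier of the head is the
  constant \<open>Suc r\<close> and the weight splits into independent summands.\<close>

lemma gf_cons:
  assumes "finite_fibres A (\<lambda>(d, e). Suc r * Suc ((d + e) div 2))" "finite_fibres (even_gaps r) weight"
  shows "finite_fibres ((\<lambda>(g, gs). g # gs) ` (A \<times> even_gaps r)) weight"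
    and "gf ((\<lambda>(g, gs). g # gs) ` (A \<times> even_gaps r)) weight
      = gf A (\<lambda>(d, e). Suc r * Suc ((d + e) div 2)) * gf (even_gaps r) weight"
proof -
  let ?v = "\<lambda>(g, gs). (case g of (d, e) \<Rightarrow> Suc r * Suc ((d + e) div 2)) + weight gs"
  have w: "weight ((\<lambda>(g, gs). g # gs) x) = 0 + ?v x" if "x \<in> A \<times> even_gaps r" for x
    using that by (auto simp: even_gaps_def)
  show "finite_fibres ((\<lambda>(g, gs). g # gs) ` (A \<times> even_gaps r)) weight"
    by (rule finite_fibres_image
        [where A = "A \<times> even_gaps r" and f = "\<lambda>(g, gs). g # gs" and w = weight
          and k = 0 and v = ?v, OF w finite_fibres_times[OF assms]])
  show "gf ((\<lambda>(g, gs). g # gs) ` (A \<times> even_gaps r)) weight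
      = gf A (\<lambda>(d, e). Suc r * Suc ((d + e) div 2)) * gf (even_gaps r) weight"
    by (subst gf_image
        [where A = "A \<times> even_gaps r" and f = "\<lambda>(g, gs). g # gs" and w = weight
          and k = 0 and v = ?v, OF w]) (simp_all only: power_0 mult_1_left gf_times[OF assms], auto simp: inj_on_def)
qed

lemma gf_even_gaps:
  "finite_fibres (even_gaps r) weight \<and>
    gf (even_gaps r) weight = (\<Prod>k=1..r. q ^ k * (1 + q ^ k) * geo k ^ 2)"
proof (induction r)
  case 0
  show ?case by (simp add: even_gaps_0 finite_fibres_def gf_singleton)
next
  case (Suc r)
  show ?case
    unfolding even_gaps_Suc
    using gf_cons[OF gf_even_pairs(1)[of "Suc r"]] gf_even_pairs(2)[of "Suc r"] Suc.IH
    by (simp add: mult.commute)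
qed

lemma gf_H_gaps_Suc:
  "gf (H_gaps (Suc r)) weight
    = 2 * q ^ Suc r * geo (Suc r) ^ 2 * (\<Prod>k=1..r. q ^ k * (1 + q ^ k) * geo k ^ 2)"
  unfolding H_gaps_Suc
  using gf_cons(2)[OF gf_odd_pairs(1)[of "Suc r"]] gf_odd_pairs(2)[of "Suc r"] gf_even_gaps[of r]
  by simp

section \<open>The product formula\<close>

definition bounded_partitions :: "nat \<Rightarrow> nat list set" where
  "bounded_partitions N = {l. is_partition l \<and> first l \<le> N}"

lemma bounded_partitions_0: "bounded_partitions 0 = {[]}"
proof -
  have "is_partition l \<and> first l \<le> 0 \<longleftrightarrow> l = []" for l by (cases l) auto
  then show ?thesis by (simp add: bounded_partitions_def)
qed

text \<open>Removing a single copy of the part \<open>Suc N\<close> leaves the same bound, which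
  yields a linear equation for the generating function.\<close>

lemma bounded_partitions_Suc:
  "bounded_partitions (Suc N) = bounded_partitions N \<union> Cons (Suc N) ` bounded_partitions (Suc N)"
proof -
  have "l \<in> bounded_partitions (Suc N) \<longleftrightarrow>
      l \<in> bounded_partitions N \<union> Cons (Suc N) ` bounded_partitions (Suc N)" for l
    by (cases l) (auto simp: bounded_partitions_def image_iff le_Suc_eq)
  then show ?thesis by blast
qed

lemma gf_bounded_partitions:
  "gf (bounded_partitions N) sum_list * (\<Prod>k=1..N. 1 - q ^ k) = 1"
proof (induction N)
  case 0
  show ?case by (simp add: bounded_partitions_0 gf_singleton)
next
  case (Suc N)
  let ?P = "\<lambda>N. gf (bounded_partitions N) sum_list"
  have "?P (Suc N) = ?P N + gf (Cons (Suc N) ` bounded_partitions (Suc N)) sum_list"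
    by (subst bounded_partitions_Suc, rule gf_Un)
      (auto intro!: finite_fibres_partitions simp: bounded_partitions_def)
  also have "gf (Cons (Suc N) ` bounded_partitions (Suc N)) sum_list = q ^ Suc N * ?P (Suc N)"
    by (rule gf_image) auto
  finally have eq: "?P (Suc N) = ?P N + q ^ Suc N * ?P (Suc N)" .
  have step: "(1 - q ^ Suc N) * ?P (Suc N) = ?P N"
    unfolding left_diff_distrib mult_1_left diff_eq_eq by (rule eq)
  have "?P (Suc N) * (\<Prod>k=1..Suc N. 1 - q ^ k)
      = ((1 - q ^ Suc N) * ?P (Suc N)) * (\<Prod>k=1..N. 1 - q ^ k)"
    by (simp add: ac_simps)
  then show ?case unfolding step Suc.IH .
qed

definition bounded_sc :: "nat \<Rightarrow> nat list set" where
  "bounded_sc N = {l. is_partition l \<and> self_conjugate l \<and> first l \<le> N}"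

lemma bounded_sc_0: "bounded_sc 0 = {[]}"
proof -
  have "is_partition l \<and> self_conjugate l \<and> first l \<le> 0 \<longleftrightarrow> l = []" for l by (cases l) auto
  then show ?thesis by (simp add: bounded_sc_def)
qed

lemma length_bounded_sc: "l \<in> bounded_sc N \<Longrightarrow> length l \<le> N"
  using self_conjugate_length by (simp add: bounded_sc_def)

text \<open>A largest part \<open>Suc N\<close> forces arm and leg \<open>N\<close> on the outermost
  hook. It has \<open>2 * N + 1\<close> cells, whence the factor \<open>1 + q ^ Suc (2 * N)\<close>
  in \<open>gf_bounded_sc\<close>.\<close>

lemma bounded_sc_Suc: "bounded_sc (Suc N) = bounded_sc N \<union> wrap N N ` bounded_sc N"
proof (intro equalityI subsetI)
  fix l assume l: "l \<in> bounded_sc (Suc N)"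
  show "l \<in> bounded_sc N \<union> wrap N N ` bounded_sc N"
  proof (cases "first l \<le> N")
    case False
    then have "l \<noteq> []" by auto
    then obtain a b l' where l': "is_partition l'" "first l' \<le> a" "length l' \<le> b" "l = wrap a b l'"
      using is_partition_wrapE l by (metis (mono_tags, lifting) bounded_sc_def mem_Collect_eq)
    then have "a = b" "self_conjugate l'" "a = N"
      using l False by (auto simp: bounded_sc_def self_conjugate_wrap)
    then show ?thesis using l' by (auto simp: bounded_sc_def)
  qed (use l in \<open>auto simp: bounded_sc_def\<close>)
next
  fix l assume "l \<in> bounded_sc N \<union> wrap N N ` bounded_sc N"
  then show "l \<in> bounded_sc (Suc N)"
    using length_bounded_sc
    by (auto simp: bounded_sc_def self_conjugate_wrap is_partition_wrap)
qed

lemma gf_bounded_sc: "gf (bounded_sc N) sum_list = (\<Prod>k<N. 1 + q ^ Suc (2 * k))"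
proof (induction N)
  case 0
  show ?case by (simp add: bounded_sc_0 gf_singleton)
next
  case (Suc N)
  have "gf (bounded_sc (Suc N)) sum_list
      = gf (bounded_sc N) sum_list + gf (wrap N N ` bounded_sc N) sum_list"
    unfolding bounded_sc_Suc
    by (rule gf_Un)
      (auto intro!: finite_fibres_partitions is_partition_wrap simp: bounded_sc_def)
  also have "gf (wrap N N ` bounded_sc N) sum_list = q ^ Suc (2 * N) * gf (bounded_sc N) sum_list"
  proof (rule gf_image)
    show "inj_on (wrap N N) (bounded_sc N)"
      by (rule inj_onI)
        (use wrap_inject length_bounded_sc in \<open>auto simp: bounded_sc_def\<close>)
  qed (simp add: length_bounded_sc mult_2)
  finally show ?case using Suc.IH by (simp add: algebra_simps)
qed

text \<open>The substitution of \<open>-q\<close> for \<open>q\<close>, which produces the signs of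
  the theorem.\<close>

definition twist :: "real fps \<Rightarrow> real fps" where
  "twist f = Abs_fps (\<lambda>n. (-1) ^ n * f $ n)"

lemma twist_nth [simp]: "twist f $ n = (-1) ^ n * f $ n"
  by (simp add: twist_def)

lemma twist_mult: "twist (f * g) = twist f * twist g"
proof (rule fps_ext)
  fix n
  have "(-1) ^ n * (f $ i * g $ (n - i)) = ((-1) ^ i * f $ i) * ((-1) ^ (n - i) * g $ (n - i))"
    if "i \<in> {0..n}" for i
  proof -
    have "(-1::real) ^ n = (-1) ^ i * (-1) ^ (n - i)"
      using that by (simp flip: power_add)
    then show ?thesis by simp
  qed
  then show "twist (f * g) $ n = (twist f * twist g) $ n"
    unfolding twist_nth fps_mult_nth sum_distrib_left by (intro sum.cong) simp_all
qed

lemma twist_gf_bounded_sc: "twist (gf (bounded_sc N) sum_list) = (\<Prod>k<N. 1 - q ^ Suc (2 * k))"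
  unfolding gf_bounded_sc
proof (induction N)
  case 0
  show ?case by (rule fps_ext) simp
next
  case (Suc N)
  have "twist (1 + q ^ Suc (2 * N)) = 1 - q ^ Suc (2 * N)"
    by (rule fps_ext) (simp add: fps_X_power_nth del: power_Suc)
  then show ?case using Suc.IH by (simp add: twist_mult del: power_Suc)
qed

text \<open>
  The telescoping sums below prove the limiting case
  \[ \sum_r \frac{(-1;q)_r\, q^{r(r-1)/2} q^{mr}}{(q;q)_r (q^m;q)_r}
     = \prod_{i \ge m} \frac{1 + q^i}{1 - q^i} \]
  of the \<open>q\<close>-Gauss sum. Its summand is \<open>gauss_term m r\<close>; in \<open>gauss_shifted m r\<close> the factor
  \<open>(q\<^sup>m;q)\<^sub>r\<close> is replaced by \<open>(q\<^sup>m\<^sup>+\<^sup>1;q)\<^sub>r\<close>.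
\<close>

fun gauss_term :: "nat \<Rightarrow> nat \<Rightarrow> real fps" where
  "gauss_term m 0 = 1"
| "gauss_term m (Suc r) = gauss_term m r * (1 + q ^ r) * q ^ (m + r) * geo (Suc r) * geo (m + r)"

fun gauss_shifted :: "nat \<Rightarrow> nat \<Rightarrow> real fps" where
  "gauss_shifted m 0 = 1"
| "gauss_shifted m (Suc r) = gauss_shifted m r * (1 + q ^ r) * q ^ (m + r) * geo (Suc r) * geo (Suc (m + r))"

text \<open>The denominators \<open>(q^m;q)_r\<close> and \<open>(q^(m+1);q)_r\<close> share all
  factors but the first of one and the last of the other.\<close>

lemma gauss_term_eq_shifted:
  assumes "m > 0"
  shows "(1 - q ^ m) * gauss_term m r = gauss_shifted m r * (1 - q ^ (m + r))"
proof (induction r)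
  case (Suc r)
  have g: "(1 - q ^ (m + r)) * geo (m + r) = 1" "geo (Suc (m + r)) * (1 - q ^ Suc (m + r)) = 1"
    using geo[of "m + r"] geo[of "Suc (m + r)"] assms by (simp_all add: mult.commute)
  let ?c = "(1 + q ^ r) * q ^ (m + r) * geo (Suc r)"
  have "(1 - q ^ m) * gauss_term m (Suc r) = ((1 - q ^ m) * gauss_term m r) * ?c * geo (m + r)"
    by (simp only: gauss_term.simps ac_simps)
  also have "\<dots> = gauss_shifted m r * ?c * ((1 - q ^ (m + r)) * geo (m + r))"
    unfolding Suc.IH by (simp only: ac_simps)
  also have "\<dots> = gauss_shifted m r * ?c * (geo (Suc (m + r)) * (1 - q ^ Suc (m + r)))"
    by (simp only: g)
  also have "\<dots> = gauss_shifted m (Suc r) * (1 - q ^ (m + Suc r))"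
    by (simp only: gauss_shifted.simps add_Suc_right ac_simps)
  finally show ?case .
qed simp

lemma gauss_term_Suc: "gauss_term (Suc m) r = gauss_shifted m r * q ^ r"
  by (induction r) (simp_all add: ac_simps)

text \<open>Passing from \<open>m\<close> to \<open>m + 1\<close> extracts the factor
  \<open>(1 + q ^ m) / (1 - q ^ m)\<close> of the product, up to a boundary term divisible by
  \<open>q ^ (m + R)\<close>.\<close>

lemma sum_gauss_term:
  assumes "m > 0"
  shows "(1 - q ^ m) * (\<Sum>r\<le>R. gauss_term m r)
    = (1 + q ^ m) * (\<Sum>r\<le>R. gauss_term (Suc m) r) - gauss_shifted m R * (1 + q ^ R) * q ^ (m + R)"
proof -
  have step: "(1 - q ^ m) * gauss_term m r - (1 + q ^ m) * gauss_term (Suc m) r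
      = gauss_shifted m r * (1 - q ^ r - 2 * q ^ (m + r))" for r
    unfolding gauss_term_eq_shifted[OF assms] gauss_term_Suc by (simp add: algebra_simps power_add)
  have telescope: "(\<Sum>r\<le>R. (1 - q ^ m) * gauss_term m r - (1 + q ^ m) * gauss_term (Suc m) r)
      = - (gauss_shifted m R * (1 + q ^ R) * q ^ (m + R))"
  proof (induction R)
    case 0
    show ?case by (simp add: algebra_simps)
  next
    case (Suc R)
    let ?r = "Suc R"
    \<comment> \<open>Inserts two factors equal to 1 to write the old boundary term as a multiple of
      the next \<open>gauss_shifted\<close> term, so that it can be combined with the new
      summand.\<close>
    have "gauss_shifted m R * (1 + q ^ R) * q ^ (m + R)
        = (gauss_shifted m R * (1 + q ^ R) * q ^ (m + R)) * (((1 - q ^ ?r) * geo ?r) * ((1 - q ^ (m + ?r)) * geo (m + ?r)))"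
      by (simp add: geo del: power_Suc)
    also have "\<dots> = gauss_shifted m ?r * ((1 - q ^ ?r) * (1 - q ^ (m + ?r)))"
      by (simp only: gauss_shifted.simps add_Suc_right ac_simps)
    finally have u: "gauss_shifted m R * (1 + q ^ R) * q ^ (m + R)
        = gauss_shifted m ?r * ((1 - q ^ ?r) * (1 - q ^ (m + ?r)))" .
    have "(\<Sum>r\<le>?r. (1 - q ^ m) * gauss_term m r - (1 + q ^ m) * gauss_term (Suc m) r)
        = gauss_shifted m ?r * (1 - q ^ ?r - 2 * q ^ (m + ?r) - (1 - q ^ ?r) * (1 - q ^ (m + ?r)))"
      unfolding sum.atMost_Suc Suc.IH step[of ?r] u
      by (simp only: right_diff_distrib uminus_add_conv_diff)
    also have "1 - q ^ ?r - 2 * q ^ (m + ?r) - (1 - q ^ ?r) * (1 - q ^ (m + ?r))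
        = - ((1 + q ^ ?r) * q ^ (m + ?r))"
      by (simp add: algebra_simps)
    finally show ?case by (simp only: mult_minus_right mult.assoc)
  qed
  have move: "x = y - z" if "x - y = - z" for x y z :: "real fps"
    using that by (simp add: diff_eq_eq)
  show ?thesis
    by (rule move) (use telescope in \<open>simp only: sum_distrib_left sum_subtractf\<close>)
qed

section \<open>Congruences modulo powers of q\<close>

lemma q_power_dvd_nth:
  assumes "q ^ n dvd f" "i < n"
  shows "f $ i = 0"
  using assms by (auto elim!: dvdE simp: fps_X_power_mult_nth)

lemma gauss_term_dvd: "q ^ m dvd (\<Sum>r\<le>R. gauss_term m r) - 1"
proof -
  have "q ^ m dvd gauss_term m (Suc r)" for r
    by (simp add: power_add dvd_mult dvd_mult2 ac_simps)
  then have "q ^ m dvd (\<Sum>r<R. gauss_term m (Suc r))" by (intro dvd_sum) simp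
  then show ?thesis by (simp add: lessThan_Suc_atMost[symmetric] sum.lessThan_Suc_shift del: sum.lessThan_Suc)
qed

text \<open>Iterates \<open>sum_gauss_term\<close> over \<open>m = 1, ..., N\<close>. Each boundary
  term contains \<open>q ^ (m + R)\<close> with \<open>m\<close> at least 1, so all vanish modulo
  \<open>q ^ Suc R\<close>.\<close>

lemma sum_gauss_term_prod:
  "q ^ Suc R dvd (\<Prod>k=1..N. 1 - q ^ k) * (\<Sum>r\<le>R. gauss_term 1 r)
    - (\<Prod>k=1..N. 1 + q ^ k) * (\<Sum>r\<le>R. gauss_term (Suc N) r)"
proof (induction N)
  case (Suc N)
  let ?A = "\<lambda>N. \<Prod>k=1..N. 1 - q ^ k" and ?B = "\<lambda>N. \<Prod>k=1..N. 1 + q ^ k"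
  let ?G = "\<lambda>m. \<Sum>r\<le>R. gauss_term m r" and ?m = "Suc N"
  let ?e = "gauss_shifted ?m R * (1 + q ^ R) * q ^ (?m + R)"
  have "q ^ Suc R dvd ?e"
    by (intro dvd_mult le_imp_power_dvd) simp
  moreover have "?A ?m * ?G 1 - ?B ?m * ?G (Suc ?m)
      = (1 - q ^ ?m) * (?A N * ?G 1 - ?B N * ?G ?m) - ?B N * ?e"
  proof -
    have A: "?A ?m = (1 - q ^ ?m) * ?A N" and B: "?B ?m = (1 + q ^ ?m) * ?B N"
      by (simp_all add: mult.commute)
    have "(1 - q ^ ?m) * (?A N * ?G 1 - ?B N * ?G ?m) - ?B N * ?e
        = (1 - q ^ ?m) * ?A N * ?G 1 - ?B N * ((1 - q ^ ?m) * ?G ?m + ?e)"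
      by (simp only: algebra_simps)
    also have "(1 - q ^ ?m) * ?G ?m + ?e = (1 + q ^ ?m) * ?G (Suc ?m)"
      by (subst sum_gauss_term) simp_all
    finally show ?thesis unfolding A B by (simp only: ac_simps)
  qed
  ultimately show ?case
    using dvd_diff[OF dvd_mult[OF Suc.IH] dvd_mult] by metis
qed simp

text \<open>Multiplying by \<open>?Q\<close> pairs \<open>1 + q ^ k\<close> with
  \<open>1 - q ^ k\<close> into the even factors \<open>1 - q ^ (2 * k)\<close>, and the first
  product supplies the odd ones. Cancelling \<open>?Q\<close> leaves a tail that is 1 modulo
  \<open>q ^ Suc N\<close>.\<close>

lemma euler_finite:
  "(\<Prod>k<N. 1 - q ^ Suc (2 * k)) * (\<Prod>k=1..N. 1 + q ^ k) = (\<Prod>k=Suc N..2 * N. 1 - q ^ k)"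
proof -
  let ?Q = "\<Prod>k=1..N. 1 - q ^ k"
  have "(\<Prod>k<N. 1 - q ^ Suc (2 * k)) * (\<Prod>k=1..N. 1 + q ^ k) * ?Q = (\<Prod>k=1..2 * N. 1 - q ^ k)"
  proof (induction N)
    case (Suc N)
    have "q ^ (2 * Suc N) = q ^ Suc N * q ^ Suc N"
      by (simp only: mult_2 power_add)
    then have key: "1 - q ^ (2 * Suc N) = (1 + q ^ Suc N) * (1 - q ^ Suc N)"
      by (simp only: algebra_simps mult_1_left mult_1_right)
    have "(\<Prod>k<Suc N. 1 - q ^ Suc (2 * k)) * (\<Prod>k=1..Suc N. 1 + q ^ k) * (\<Prod>k=1..Suc N. 1 - q ^ k)
      = (\<Prod>k<N. 1 - q ^ Suc (2 * k)) * (\<Prod>k=1..N. 1 + q ^ k) * (\<Prod>k=1..N. 1 - q ^ k)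
        * ((1 - q ^ Suc (2 * N)) * (1 - q ^ (2 * Suc N)))"
      unfolding key by (simp add: ac_simps del: power_Suc)
    also have "\<dots> = (\<Prod>k=1..2 * Suc N. 1 - q ^ k)"
      unfolding Suc.IH by (simp add: mult.assoc del: power_Suc)
    finally show ?case .
  qed simp
  also have "(\<Prod>k=1..2 * N. 1 - q ^ k) = ?Q * (\<Prod>k=Suc N..2 * N. 1 - q ^ k)"
    by (subst prod.ub_add_nat[of 1 N _ N, simplified mult_2[symmetric]]) simp_all
  finally have "?Q * ((\<Prod>k<N. 1 - q ^ Suc (2 * k)) * (\<Prod>k=1..N. 1 + q ^ k))
      = ?Q * (\<Prod>k=Suc N..2 * N. 1 - q ^ k)" by (simp only: ac_simps)
  moreover have "?Q \<noteq> 0" using gf_bounded_partitions[of N] by (metis mult_zero_right zero_neq_one)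
  ultimately show ?thesis by (simp only: mult_cancel_left) blast
qed

lemma prod_dvd:
  assumes "finite K" "\<And>k. k \<in> K \<Longrightarrow> n \<le> k"
  shows "q ^ n dvd (\<Prod>k\<in>K. 1 - q ^ k) - 1"
  using assms
proof (induction K rule: finite_induct)
  case (insert k K)
  let ?P = "\<Prod>k\<in>K. 1 - q ^ k"
  have "(\<Prod>k\<in>insert k K. 1 - q ^ k) - 1 = (?P - 1) - q ^ k * ?P"
    using insert by (simp add: algebra_simps)
  moreover have "q ^ n dvd q ^ k * ?P"
    using insert by (intro dvd_mult2 le_imp_power_dvd) simp
  moreover have "q ^ n dvd ?P - 1" using insert by simp
  ultimately show ?case by (simp only:) (rule dvd_diff)
qed simp

text \<open>In \<open>gauss_term\<close> the factors \<open>1 + q ^ k\<close> start at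
  \<open>k = 0\<close>; this first factor is the 2 of the odd innermost pair.\<close>

lemma gf_H_gaps: "gf (H_gaps r) weight = gauss_term 1 r"
proof (cases r)
  case 0
  show ?thesis by (simp add: 0 H_gaps_0 gf_singleton)
next
  case (Suc r)
  have "2 * (\<Prod>k=1..r. q ^ k * (1 + q ^ k) * geo k ^ 2) = gauss_term 1 r * (1 + q ^ r)"
  proof (induction r)
    case (Suc r)
    have "2 * (\<Prod>k=1..Suc r. q ^ k * (1 + q ^ k) * geo k ^ 2)
        = (2 * (\<Prod>k=1..r. q ^ k * (1 + q ^ k) * geo k ^ 2))
          * (q ^ Suc r * (1 + q ^ Suc r) * geo (Suc r) ^ 2)"
      by simp
    then show ?case
      unfolding Suc.IH by (simp only: gauss_term.simps power2_eq_square plus_1_eq_Suc ac_simps)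
  qed simp
  then have "gauss_term 1 (Suc r) = (2 * (\<Prod>k=1..r. q ^ k * (1 + q ^ k) * geo k ^ 2))
      * (q ^ Suc r * geo (Suc r) ^ 2)"
    by (simp only: gauss_term.simps power2_eq_square plus_1_eq_Suc ac_simps)
  then show ?thesis
    unfolding Suc gf_H_gaps_Suc by (simp only: ac_simps)
qed

lemma gf_product:
  "q ^ Suc N dvd twist (gf (bounded_sc N) sum_list) * (\<Sum>r\<le>N. gauss_term 1 r) - gf (bounded_partitions N) sum_list"
proof -
  let ?S = "twist (gf (bounded_sc N) sum_list)" and ?P = "gf (bounded_partitions N) sum_list"
  let ?Q = "\<Prod>k=1..N. 1 - q ^ k" and ?B = "\<Prod>k=1..N. 1 + q ^ k"
  let ?G = "\<lambda>m. \<Sum>r\<le>N. gauss_term m r" and ?Z = "\<Prod>k=Suc N..2 * N. 1 - q ^ k"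
  have PQ: "?P * ?Q = 1" by (rule gf_bounded_partitions)
  have SB: "?S * ?B = ?Z" by (simp only: twist_gf_bounded_sc euler_finite)
  have "?S * ?G 1 - ?P = (?P * ?Q) * (?S * ?G 1) - ?P" by (simp only: PQ mult_1_left)
  \<comment> \<open>Splits \<open>?S * ?Q * ?G 1 - 1\<close> into three errors: moving the sum from
    1 to \<open>Suc N\<close>, replacing that sum by 1, and replacing Euler's product by 1.\<close>
  also have "\<dots> = ?P * (?S * (?Q * ?G 1 - ?B * ?G (Suc N)) + (?S * ?B) * (?G (Suc N) - 1) + (?S * ?B - 1))"
    by (simp only: algebra_simps mult_1_left mult_1_right)
  finally have eq: "?S * ?G 1 - ?P
      = ?P * (?S * (?Q * ?G 1 - ?B * ?G (Suc N)) + ?Z * (?G (Suc N) - 1) + (?Z - 1))"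
    by (simp only: SB)
  have "q ^ Suc N dvd ?Z - 1" by (rule prod_dvd) auto
  then show ?thesis
    unfolding eq by (intro dvd_mult dvd_add sum_gauss_term_prod gauss_term_dvd)
qed

theorem corollary5p5:
  fixes n :: nat
  shows "int (num_partitions n) =
    (\<Sum>j = 0..n. (-1) ^ j * int (sc j) * int (card (H_even (2 * (n - j)))))"
proof -
  let ?S = "twist (gf (bounded_sc n) sum_list)" and ?G = "\<Sum>r\<le>n. gauss_term 1 r"
  \<comment> \<open>Makes the bound \<open>n\<close> on the largest part harmless in all degrees up
    to \<open>n\<close>.\<close>
  have first_le: "first l \<le> sum_list l" for l by (cases l) auto
  have "gf (bounded_partitions n) sum_list $ n = real (num_partitions n)"
  proof -
    have "{l \<in> bounded_partitions n. sum_list l = n} = partitions n"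
      using first_le by (auto simp: bounded_partitions_def partitions_def)
    then show ?thesis by (simp add: num_partitions_def)
  qed
  moreover have "?S $ j = (-1) ^ j * real (sc j)" if "j \<le> n" for j
  proof -
    have "{l \<in> bounded_sc n. sum_list l = j} = {l \<in> partitions j. self_conjugate l}"
      using first_le order.trans[OF _ that] by (auto simp: bounded_sc_def partitions_def)
    then show ?thesis by (simp add: sc_def)
  qed
  moreover have "?G $ m = real (card (H_even (2 * m)))" if "m \<le> n" for m
    unfolding card_H_even[OF that] fps_sum_nth gf_H_gaps[symmetric] by simp
  \<comment> \<open>The congruence modulo \<open>q ^ Suc n\<close> still decides the coefficient of
    \<open>q ^ n\<close>.\<close>
  moreover have "(?S * ?G) $ n = gf (bounded_partitions n) sum_list $ n"
    using q_power_dvd_nth[OF gf_product, of n n] by simp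
  ultimately have "real (num_partitions n)
      = (\<Sum>j = 0..n. (-1) ^ j * real (sc j) * real (card (H_even (2 * (n - j)))))"
    by (simp add: fps_mult_nth del: gf_nth twist_nth)
  also have "\<dots> = real_of_int (\<Sum>j = 0..n. (-1) ^ j * int (sc j) * int (card (H_even (2 * (n - j)))))"
    by simp
  finally show ?thesis by (metis of_int_eq_iff of_int_of_nat_eq)
qed

end
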